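(* Let $p,q\in\mathbb{R}$ and let $f:(0,\infty)\to(0,\infty)$ be a differentiable, strictly decreasing, convex function which maps $(0,\infty)$ onto $(0,\infty)$, and let $g:(0,\infty)\to(0,\infty)$ be its inverse. If $f$ is $(p,q)$-convex, then $g$ is $(q,p)$-convex.
   Context: For real numbers $p,q$, a differentiable function $f:(0,\infty)\to(0,\infty)$ is called $(p,q)$-convex if and only if the function $x\mapsto x^{1-p}\,f'(x)\,(f(x))^{q-1}$ is increasing (i.e. nondecreasing) on $(0,\infty)$. *)

theory Defs
  imports "HOL-Analysis.Analysis"
begin

text \<open>
  A function on the positive half-line is represented by a total function whose values outside
  \<open>{0<..}\<close> are irrelevant. As that set is open, differentiability on it and \<open>deriv\<close> at its points
  depend only on the restriction. All bases of \<open>powr\<close> below are positive.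
\<close>

definition pq_convex :: "real \<Rightarrow> real \<Rightarrow> (real \<Rightarrow> real) \<Rightarrow> bool" where
  "pq_convex p q f \<longleftrightarrow>
     f \<in> {0<..} \<rightarrow> {0<..} \<and>
     f differentiable_on {0<..} \<and>
     mono_on {0<..} (\<lambda>x. x powr (1 - p) * deriv f x * f x powr (q - 1))"

end

theory Submission
  imports Defs "HOL-Complex_Analysis.Conformal_Mappings"
begin

text \<open>
  Write \<open>F x = x powr (1 - p) * deriv f x * f x powr (q - 1)\<close> and let \<open>G\<close> be the corresponding
  expression for \<open>g\<close> with \<open>p\<close> and \<open>q\<close> exchanged. A convex, strictly decreasing function has negative
  derivative everywhere, since a tangent of nonnegative slope would support its graph from below
  and prevent it from decreasing (\<open>strict_antimono_convex_deriv_neg\<close>). Hence the inverse function theorem applies at every point, and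
  \<open>deriv g y = 1 / deriv f (g y)\<close>. Substituting \<open>x = g y\<close> and \<open>y = f x\<close> turns the powers in \<open>G y\<close> into
  the reciprocals of those in \<open>F x\<close>, so \<open>G y = 1 / F (g y)\<close>. Now \<open>g\<close> is decreasing, \<open>F\<close> is
  nondecreasing and negative, and the reciprocal is decreasing on the negative numbers: the two
  reversals cancel, and \<open>G\<close> is nondecreasing.
\<close>

text \<open>
  Monotonicity alone would allow a zero derivative. Convexity excludes it: the graph lies above its
  tangent at \<open>x\<close>, so the slope is at most the increment of \<open>f\<close> from \<open>x\<close> to \<open>x + 1\<close>. The strict
  sign is what makes the inverse differentiable.
\<close>

lemma strict_antimono_convex_deriv_neg:
  fixes f :: "real \<Rightarrow> real"
  assumes convex: "convex_on {0<..} f" and anti: "strict_antimono_on {0<..} f"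
    and D: "(f has_real_derivative D) (at x)" and x: "x > 0"
  shows "D < 0"
proof -
  have "f (x + 1) - f x \<ge> D * ((x + 1) - x)"
    using convex
  proof (rule convex_on_imp_above_tangent)
    show "x \<in> interior {0<..}" using x by (simp add: interior_open)
    show "(f has_real_derivative D) (at x within {0<..})"
      using D by (rule has_field_derivative_at_within)
  qed (use x in auto)
  moreover have "f (x + 1) < f x"
    using anti x by (auto simp: monotone_on_def)
  ultimately show ?thesis by simp
qed

theorem theorem1:
  fixes p q :: real and f g :: "real \<Rightarrow> real"
  assumes "f differentiable_on {0<..}"
    and "strict_antimono_on {0<..} f"
    and "convex_on {0<..} f"
    and "f ` {0<..} = {0<..}"
    and "g \<in> {0<..} \<rightarrow> {0<..}"
    and "\<And>x. x > 0 \<Longrightarrow> g (f x) = x"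
    and "\<And>y. y > 0 \<Longrightarrow> f (g y) = y"
    and "pq_convex p q f"
  shows "pq_convex q p g"
proof -
  define F where "F x = x powr (1 - p) * deriv f x * f x powr (q - 1)" for x
  have F_mono: "mono_on {0<..} F"
    using assms(8) by (simp add: pq_convex_def F_def[abs_def])
  have g_pos: "g y > 0" if "y > 0" for y
    using assms(5) that by auto
  have f_deriv: "(f has_real_derivative deriv f x) (at x)" if "x > 0" for x
    using assms(1) that
    by (simp add: differentiable_on_def at_within_open[of _ "{0<..}"] DERIV_deriv_iff_real_differentiable)
  have f'_neg: "deriv f x < 0" if "x > 0" for x
    using strict_antimono_convex_deriv_neg[OF assms(3,2) f_deriv that] that by simp
  have g_deriv: "(g has_real_derivative inverse (deriv f (g y))) (at y)" if "y > 0" for y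
    using differentiable_imp_continuous_on[OF assms(1)] f_deriv f'_neg[of "g y"]
      assms(6) assms(7)[OF that] g_pos[OF that]
    by (intro has_field_derivative_inverse_strong_x[where S = "{0<..}" and f = f]) auto
  have F_neg: "F (g y) < 0" if "y > 0" for y
    using that g_pos[OF that] f'_neg[OF g_pos[OF that]] assms(7)[OF that]
    by (simp add: F_def mult_less_0_iff)
  have G_eq: "y powr (1 - q) * deriv g y * g y powr (p - 1) = inverse (F (g y))" if "y > 0" for y
  proof -
    have "inverse (F (g y))
        = g y powr (- (1 - p)) * inverse (deriv f (g y)) * y powr (- (q - 1))"
      by (simp only: F_def assms(7)[OF that] powr_minus inverse_mult_distrib)
    then show ?thesis
      using DERIV_imp_deriv[OF g_deriv[OF that]] by simp
  qed
  have g_antimono: "g z \<le> g y" if "0 < y" "y \<le> z" for y z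
  proof (rule ccontr)
    assume "\<not> g z \<le> g y"
    then have "f (g z) < f (g y)"
      using assms(2) g_pos that by (auto simp: monotone_on_def)
    then show False
      using assms(7) that by simp
  qed
  have "mono_on {0<..} (\<lambda>y. y powr (1 - q) * deriv g y * g y powr (p - 1))"
  proof (rule mono_onI)
    fix y z :: real
    assume "y \<in> {0<..}" "z \<in> {0<..}" "y \<le> z"
    then have yz: "0 < y" "0 < z" "y \<le> z" by auto
    have "F (g z) \<le> F (g y)"
      using F_mono g_antimono[OF yz(1,3)] g_pos yz by (auto intro: mono_onD)
    then have "inverse (F (g y)) \<le> inverse (F (g z))"
      using F_neg yz by (simp add: le_imp_inverse_le_neg)
    then show "y powr (1 - q) * deriv g y * g y powr (p - 1)
        \<le> z powr (1 - q) * deriv g z * g z powr (p - 1)"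
      by (simp only: G_eq yz)
  qed
  moreover have "g differentiable_on {0<..}"
    using g_deriv
    by (intro differentiable_at_imp_differentiable_on)
      (metis greaterThan_iff real_differentiable_def)
  ultimately show ?thesis
    using assms(5) by (simp add: pq_convex_def)
qed

end
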